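(* Let $A$ be a partially ordered set with $N$ elements, let $\Xi_N=\{\xi_1<\dots<\xi_N\}\subset\Xi$, let $B=\{\beta_1,\dots,\beta_n\}\subset A$, $n\le N$, and let $F$, $S(B,f)$, $\Pi_k$, $\Pi^k$ be as defined in the context. If $\beta_k\prec\beta_{k+1}$ for all $k=1,\dots,n-1$, then $$\min_{f\in F}S(B,f)=\sum_{k=1}^n\xi_{|\Pi_k|}\quad\text{and}\quad\max_{f\in F}S(B,f)=\sum_{k=1}^n\xi_{N-|\Pi^k|+1}.$$
   Context: $N\in\mathbb{N}$ and $A=\{\alpha_1,\dots,\alpha_N\}$ is a set of $N$ elements with a partial order $\preceq$; $\alpha\prec\beta$ means $\alpha\preceq\beta$ and $\alpha\ne\beta$. $\Xi$ is a linearly ordered set with order $\le$ and a commutative associative binary operation $+$ such that for all $\xi,\eta,\zeta\in\Xi$, $\xi<\eta$ implies $\xi+\zeta<\eta+\zeta$. $\Xi_N=\{\xi_1,\dots,\xi_N\}\subset\Xi$ is a subset of $N$ different elements $\xi_1<\xi_2<\dots<\xi_N$. $F$ is the set of all bijections $f\colon A\to\Xi_N$ that are non-decreasing, i.e. $\alpha\preceq\beta$ implies $f(\alpha)\le f(\beta)$. $B=\{\beta_1,\dots,\beta_n\}$ is a fixed set of $n$ distinct elements of $A$, and for $f\in F$, $S(B,f)=\sum_{k=1}^n f(\beta_k)$ (sum with respect to $+$ in $\Xi$). For $k=1,\dots,n$, $\Pi_k=\{\beta\in A\colon\beta\preceq\beta_k\}$ and $\Pi^k=\{\beta\in A\colon\beta_k\preceq\beta\}$.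 $|C|$ is the number of elements of a finite set $C$. *)

theory Defs
  imports Main "HOL-Library.FuncSet"
begin

text \<open>No neutral element, no subtraction and no positivity is required, so that this is more
  general than the cancellative ordered semigroups of the library, which carry a
  subtraction operation.\<close>

class strict_linorder_ab_semigroup_add = linorder + ab_semigroup_add +
  assumes add_strict_mono_right: "x < y \<Longrightarrow> x + z < y + z"

text \<open>The sum \<open>g 1 + \<dots> + g n\<close> for \<open>n \<ge> 1\<close>. The library's \<^const>\<open>sum\<close> cannot be used, since it
  needs a zero. The value at \<open>n = 0\<close> is unspecified.\<close>

fun semigroup_sum :: "(nat \<Rightarrow> 'b::ab_semigroup_add) \<Rightarrow> nat \<Rightarrow> 'b" where
  "semigroup_sum g (Suc 0) = g 1"
| "semigroup_sum g (Suc (Suc n)) = semigroup_sum g (Suc n) + g (Suc (Suc n))"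

lemma semigroup_sum_eq_sum:
  fixes g :: "nat \<Rightarrow> 'b::comm_monoid_add"
  assumes "n \<ge> 1"
  shows "semigroup_sum g n = (\<Sum>k=1..n. g k)"
  using assms by (induction g n rule: semigroup_sum.induct) auto

text \<open>Functions are made extensional outside \<open>A\<close> so that each map from \<open>A\<close> to \<open>X\<close> is
  represented exactly once; in particular the set is finite if \<open>A\<close> and \<open>X\<close> are.\<close>

definition monotone_bijections :: "'a set \<Rightarrow> 'a rel \<Rightarrow> 'b::linorder set \<Rightarrow> ('a \<Rightarrow> 'b) set" where
  "monotone_bijections A r X =
    {f \<in> A \<rightarrow>\<^sub>E X. bij_betw f A X \<and> monotone_on A (\<lambda>a b. (a, b) \<in> r) (\<le>) f}"

lemma finite_monotone_bijections:
  "finite A \<Longrightarrow> finite X \<Longrightarrow> finite (monotone_bijections A r X)"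
  unfolding monotone_bijections_def by (simp add: finite_PiE)

definition S :: "(nat \<Rightarrow> 'a) \<Rightarrow> nat \<Rightarrow> ('a \<Rightarrow> 'b::ab_semigroup_add) \<Rightarrow> 'b" where
  "S \<beta> n f = semigroup_sum (\<lambda>k. f (\<beta> k)) n"

definition lower_cone :: "'a set \<Rightarrow> 'a rel \<Rightarrow> 'a \<Rightarrow> 'a set" where
  "lower_cone A r a = {b \<in> A. (b, a) \<in> r}"

definition upper_cone :: "'a set \<Rightarrow> 'a rel \<Rightarrow> 'a \<Rightarrow> 'a set" where
  "upper_cone A r a = {b \<in> A. (a, b) \<in> r}"

end

theory Submission
  imports Defs
begin

text \<open>Up to the increasing enumeration \<open>\<xi>\<close>, an element of \<open>F\<close> is a linear extension
  \<open>p\<close> of the order, and \<open>p a\<close> is at least the size of the lower cone of \<open>a\<close>, since \<open>p\<close> embeds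
  this cone in \<open>{1..p a}\<close>. For a chain \<open>C\<close> all these bounds are attained at once: the number of elements
  of \<open>C\<close> that are not above \<open>a\<close> is a monotone function of \<open>a\<close>, and if a linear extension
  sorts by it first, then only the lower cone of \<open>c \<in> C\<close> comes before \<open>c\<close>. The maximum is
  the minimum for the converse order, with positions counted from the end.\<close>

section \<open>Monotonicity of sums in an ordered commutative semigroup\<close>

lemma semigroup_sum_mono:
  fixes g h :: "nat \<Rightarrow> 'b::strict_linorder_ab_semigroup_add"
  assumes "1 \<le> n" and "\<And>k. k \<in> {1..n} \<Longrightarrow> g k \<le> h k"
  shows "semigroup_sum g n \<le> semigroup_sum h n"
  using assms
proof (induction n rule: nat_induct_at_least)
  case base
  then show ?case by simp
next
  case (Suc n)
  have add_right: "x + z \<le> y + z" if "x \<le> y" for x y z :: 'b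
    using that add_strict_mono_right[of x y z] by (auto simp: le_less)
  \<comment> \<open>The recursive equation of \<open>semigroup_sum\<close> matches only
    \<open>Suc (Suc m)\<close>, so \<open>n\<close> is exposed as a successor for the final
    simplification.\<close>
  obtain m where m: "n = Suc m" using Suc.hyps by (cases n) auto
  have "semigroup_sum g n + g (Suc n) \<le> semigroup_sum h n + g (Suc n)"
    by (rule add_right) (use Suc in auto)
  also have "\<dots> \<le> semigroup_sum h n + h (Suc n)"
    using add_right[of "g (Suc n)" "h (Suc n)" "semigroup_sum h n"] Suc.prems
    by (simp add: add.commute)
  finally show ?case by (simp add: m)
qed

lemma semigroup_sum_cong:
  fixes g h :: "nat \<Rightarrow> 'b::strict_linorder_ab_semigroup_add"
  assumes "1 \<le> n" and "\<And>k. k \<in> {1..n} \<Longrightarrow> g k = h k"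
  shows "semigroup_sum g n = semigroup_sum h n"
  using assms by (intro order.antisym semigroup_sum_mono) auto

section \<open>Linear extensions and their bounds by cones\<close>

definition linear_extension :: "'a set \<Rightarrow> 'a rel \<Rightarrow> ('a \<Rightarrow> nat) \<Rightarrow> bool" where
  "linear_extension A r p \<longleftrightarrow>
    bij_betw p A {1..card A} \<and> monotone_on A (\<lambda>a b. (a, b) \<in> r) (\<le>) p"

lemma linear_extension_range:
  assumes "linear_extension A r p" and "a \<in> A"
  shows "p a \<in> {1..card A}"
  using assms by (auto simp: linear_extension_def dest: bij_betwE)

text \<open>Counting positions from the end is an order-reversing involution of
  \<open>{1..card A}\<close>. This carries results on lower cones over to upper cones.\<close>

lemma linear_extension_converse:
  assumes "linear_extension A r p"
  shows "linear_extension A (r\<inverse>) (\<lambda>a. card A + 1 - p a)"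
proof -
  have "bij_betw (\<lambda>i. card A + 1 - i) {1..card A} {1..card A}"
    by (rule bij_betwI[where g = "\<lambda>i. card A + 1 - i"]) auto
  then have "bij_betw (\<lambda>a. card A + 1 - p a) A {1..card A}"
    using assms bij_betw_trans unfolding linear_extension_def comp_def by fastforce
  then show ?thesis
    using assms unfolding linear_extension_def by (auto simp: monotone_on_def intro: diff_le_mono2)
qed

lemma card_lower_cone_le:
  assumes "linear_extension A r p" and "a \<in> A"
  shows "card (lower_cone A r a) \<le> p a"
proof -
  have "p ` lower_cone A r a \<subseteq> {1..p a}"
    using assms linear_extension_range[OF assms(1)]
    by (force simp: linear_extension_def lower_cone_def monotone_on_def)
  moreover have "inj_on p (lower_cone A r a)"
    using assms by (auto simp: linear_extension_def lower_cone_def bij_betw_def inj_on_def)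
  ultimately have "card (lower_cone A r a) \<le> card {1..p a}"
    by (intro card_inj_on_le) auto
  then show ?thesis by simp
qed

lemma lower_cone_converse: "lower_cone A (r\<inverse>) a = upper_cone A r a"
  by (simp add: lower_cone_def upper_cone_def)

lemma le_card_upper_cone:
  assumes "linear_extension A r p" and "a \<in> A"
  shows "p a \<le> card A - card (upper_cone A r a) + 1"
  \<comment> \<open>The bound for the converse order reads
    \<open>card (upper_cone A r a) \<le> card A + 1 - p a\<close>. As \<open>p a\<close> lies in
    \<open>{1..card A}\<close>, the subtractions on naturals are exact and can be
    rearranged.\<close>
  using card_lower_cone_le[OF linear_extension_converse[OF assms(1)] assms(2)]
    linear_extension_range[OF assms]
  unfolding lower_cone_converse atLeastAtMost_iff by arith

section \<open>Existence of extremal linear extensions\<close>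

text \<open>Topological sorting: an element of \<open>A\<close> minimal for \<open>s\<close> takes
  position 1, and an enumeration of the rest is shifted up by one.\<close>

lemma finite_wf_enumeration:
  assumes "finite A" and "wf s"
  shows "\<exists>p. bij_betw p A {1..card A} \<and> (\<forall>a\<in>A. \<forall>b\<in>A. (a, b) \<in> s \<longrightarrow> p a < p b)"
  using assms(1)
\<comment> \<open>The rule offers the hypothesis for the removal of any element, so a minimal one
  can be chosen.\<close>
proof (induction A rule: finite_remove_induct)
  case empty
  show ?case by (simp add: bij_betw_def)
next
  case (remove A)
  obtain x where x: "x \<in> A" and minimal: "\<And>y. (y, x) \<in> s \<Longrightarrow> y \<notin> A"
    using wfE_min[OF assms(2)] remove.hyps(2) by (metis ex_in_conv)
  obtain p where p: "bij_betw p (A - {x}) {1..card (A - {x})}"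
    and p_less: "\<And>a b. a \<in> A - {x} \<Longrightarrow> b \<in> A - {x} \<Longrightarrow> (a, b) \<in> s \<Longrightarrow> p a < p b"
    using remove.IH[OF x] by blast
  define q where "q a = (if a = x then 1 else Suc (p a))" for a
  have card_A: "card A = Suc (card (A - {x}))"
    using remove.hyps(1) x by (rule card.remove)
  have "bij_betw Suc {1..card (A - {x})} {2..card A}"
    by (simp add: bij_betw_def card_A numeral_2_eq_2)
  with p have "bij_betw (Suc \<circ> p) (A - {x}) {2..card A}"
    by (rule bij_betw_trans)
  then have "bij_betw q (A - {x}) {2..card A}"
    by (rule bij_betw_cong[THEN iffD1, rotated]) (simp add: q_def)
  moreover have "bij_betw q {x} {1}"
    by (simp add: q_def bij_betw_def)
  ultimately have "bij_betw q ((A - {x}) \<union> {x}) ({2..card A} \<union> {1})"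
    by (rule bij_betw_combine) auto
  moreover have "(A - {x}) \<union> {x} = A" using x by auto
  moreover have "{2..card A} \<union> {1} = {1..card A}" using card_A by auto
  ultimately have "bij_betw q A {1..card A}" by simp
  moreover have "q a < q b" if "a \<in> A" "b \<in> A" "(a, b) \<in> s" for a b
  proof -
    have "b \<noteq> x" using that minimal by blast
    \<comment> \<open>For \<open>a = x\<close> this gives \<open>q a = 1 < q b\<close>; otherwise
      both positions are shifted equally.\<close>
    then have "p b \<in> {1..card (A - {x})}" using bij_betwE[OF p] that(2) by blast
    then show ?thesis using that p_less[of a b] \<open>b \<noteq> x\<close> by (auto simp: q_def)
  qed
  ultimately show ?case by blast
qed

lemma linear_extension_minimal_on_chain:
  assumes "finite A" and "partial_order_on A r" and "C \<subseteq> A"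
    and chain: "\<And>x y. x \<in> C \<Longrightarrow> y \<in> C \<Longrightarrow> (x, y) \<in> r \<or> (y, x) \<in> r"
  shows "\<exists>p. linear_extension A r p \<and> (\<forall>c\<in>C. p c = card (lower_cone A r c))"
proof -
  have refl: "\<And>a. a \<in> A \<Longrightarrow> (a, a) \<in> r" and antisym: "antisym r" and trans: "trans r"
    and "r \<subseteq> A \<times> A"
    using assms(2) by (auto simp: partial_order_on_def preorder_on_def refl_on_def)
  have "finite r" using \<open>r \<subseteq> A \<times> A\<close> assms(1) by (meson finite_SigmaI finite_subset)
  moreover have "acyclic (r - Id)"
    using antisym trans by (simp add: acyclic_irrefl irrefl_def trancl_id trans_diff_Id)
  ultimately have wf: "wf (r - Id)" by (simp add: finite_acyclic_wf)
  have "finite C" using assms(1,3) finite_subset by blast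
  define not_above where "not_above a = {c \<in> C. (a, c) \<notin> r}" for a
  define m where "m a = card (not_above a)" for a
  \<comment> \<open>\<open><*mlex*>\<close> compares by \<open>m\<close> first and resolves ties by
    the strict order \<open>r - Id\<close>.\<close>
  obtain p where p: "bij_betw p A {1..card A}"
    and p_less: "\<And>a b. a \<in> A \<Longrightarrow> b \<in> A \<Longrightarrow> (a, b) \<in> m <*mlex*> (r - Id) \<Longrightarrow> p a < p b"
    using finite_wf_enumeration[OF assms(1) wf_mlex[OF wf, of m]] by blast
  \<comment> \<open>Whatever lies above \<open>b\<close> also lies above \<open>a\<close>. Hence
    sorting by \<open>m\<close> first never contradicts \<open>r\<close>.\<close>
  have m_mono: "m a \<le> m b" if "(a, b) \<in> r" for a b
    unfolding m_def not_above_def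
    using that trans \<open>finite C\<close> by (intro card_mono) (auto dest: transD)
  have p_mono: "p a \<le> p b" if "a \<in> A" "b \<in> A" "(a, b) \<in> r" for a b
  proof (cases "a = b")
    case False
    then have "(a, b) \<in> m <*mlex*> (r - Id)"
      using that m_mono by (simp add: mlex_leq)
    then show ?thesis using that p_less by (simp add: less_imp_le)
  qed simp
  then have ext: "linear_extension A r p"
    using p by (simp add: linear_extension_def monotone_on_def)
  have "p c = card (lower_cone A r c)" if "c \<in> C" for c
  proof (rule order.antisym)
    have "c \<in> A" using that assms(3) by blast
    have below: "(a, c) \<in> r" if "a \<in> A" "p a \<le> p c" for a
    proof (rule ccontr)
      assume "(a, c) \<notin> r"
      \<comment> \<open>A chain element not above \<open>c\<close> is below \<open>c\<close>; were
        it also above \<open>a\<close>, then \<open>a\<close> would be below \<open>c\<close>. The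
        inclusion is strict because \<open>c\<close> lies in \<open>not_above a\<close> but, by
        reflexivity, not in \<open>not_above c\<close>.\<close>
      have "not_above c \<subset> not_above a"
      proof
        show "not_above c \<subseteq> not_above a"
          using chain[OF _ \<open>c \<in> C\<close>] \<open>(a, c) \<notin> r\<close> trans
          unfolding not_above_def by (blast dest: transD)
        show "not_above c \<noteq> not_above a"
          using \<open>c \<in> C\<close> \<open>(a, c) \<notin> r\<close> refl[OF \<open>c \<in> A\<close>] unfolding not_above_def by blast
      qed
      moreover have "finite (not_above a)"
        using \<open>finite C\<close> by (simp add: not_above_def)
      ultimately have "m c < m a"
        unfolding m_def by (intro psubset_card_mono)
      then have "p c < p a"
        using p_less[OF \<open>c \<in> A\<close> that(1)] by (simp add: mlex_less)
      then show False using that(2) by simp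
    qed
    \<comment> \<open>Every position up to \<open>p c\<close> is occupied since \<open>p\<close> is
      onto, and \<open>below\<close> puts its occupant in the lower cone.\<close>
    have "{1..p c} \<subseteq> p ` lower_cone A r c"
    proof
      fix i assume i: "i \<in> {1..p c}"
      then have "i \<in> {1..card A}"
        using linear_extension_range[OF ext \<open>c \<in> A\<close>] by simp
      then obtain a where "a \<in> A" "p a = i"
        using p by (metis bij_betw_imp_surj_on imageE)
      then show "i \<in> p ` lower_cone A r c"
        using below i by (auto simp: lower_cone_def)
    qed
    moreover have "finite (lower_cone A r c)"
      using assms(1) by (simp add: lower_cone_def)
    ultimately show "p c \<le> card (lower_cone A r c)"
      using surj_card_le by fastforce
    show "card (lower_cone A r c) \<le> p c"
      using card_lower_cone_le[OF ext \<open>c \<in> A\<close>] .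
  qed
  then show ?thesis using ext by blast
qed

lemma linear_extension_maximal_on_chain:
  assumes "finite A" and "partial_order_on A r" and "C \<subseteq> A"
    and chain: "\<And>x y. x \<in> C \<Longrightarrow> y \<in> C \<Longrightarrow> (x, y) \<in> r \<or> (y, x) \<in> r"
  shows "\<exists>p. linear_extension A r p \<and> (\<forall>c\<in>C. p c = card A - card (upper_cone A r c) + 1)"
proof -
  obtain p where p: "linear_extension A (r\<inverse>) p" "\<And>c. c \<in> C \<Longrightarrow> p c = card (upper_cone A r c)"
    using linear_extension_minimal_on_chain[OF assms(1) _ assms(3), of "r\<inverse>"] assms(2) chain
    by (auto simp: lower_cone_converse)
  have "card A + 1 - p c = card A - card (upper_cone A r c) + 1" if "c \<in> C" for c
  proof -
    \<comment> \<open>On naturals, \<open>card A + 1 - u\<close> and \<open>card A - u + 1\<close>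
      differ once \<open>u\<close> exceeds \<open>card A\<close>; the range of \<open>p\<close>
      excludes this.\<close>
    have "p c \<le> card A" using linear_extension_range[OF p(1)] that assms(3) by auto
    then show ?thesis using p(2)[OF that] by simp
  qed
  then show ?thesis using linear_extension_converse[OF p(1)] by auto
qed

section \<open>Passage to monotone bijections and their sums\<close>

text \<open>On the positions, \<open>\<xi>\<close> is an order isomorphism onto its image, so
  composition with it or its inverse translates between the two notions. Restricting to
  \<open>A\<close> yields the extensional representative.\<close>

lemma monotone_bijections_iff_linear_extension:
  fixes \<xi> :: "nat \<Rightarrow> 'b::linorder"
  assumes "strict_mono_on {1..card A} \<xi>"
  shows "f \<in> monotone_bijections A r (\<xi> ` {1..card A}) \<longleftrightarrow>
    (\<exists>p. linear_extension A r p \<and> f = restrict (\<xi> \<circ> p) A)"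
proof
  let ?I = "{1..card A}"
  have bij: "bij_betw \<xi> ?I (\<xi> ` ?I)"
    using assms by (simp add: bij_betw_def strict_mono_on_imp_inj_on)
  \<comment> \<open>Reflection of \<open>\<le>\<close> serves the forward direction, preservation
    the backward one.\<close>
  have le_iff: "\<xi> i \<le> \<xi> j \<longleftrightarrow> i \<le> j" if "i \<in> ?I" "j \<in> ?I" for i j
    using assms that by (simp add: strict_mono_on_less_eq)
  {
    assume f: "f \<in> monotone_bijections A r (\<xi> ` ?I)"
    define p where "p = inv_into ?I \<xi> \<circ> f"
    have "bij_betw f A (\<xi> ` ?I)"
      using f by (simp add: monotone_bijections_def)
    then have p: "bij_betw p A ?I"
      unfolding p_def by (rule bij_betw_trans[OF _ bij_betw_inv_into[OF bij]])
    have f_eq: "f a = \<xi> (p a)" if "a \<in> A" for a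
      using f that unfolding p_def comp_def monotone_bijections_def
      by (intro f_inv_into_f[symmetric]) auto
    then have "f = restrict (\<xi> \<circ> p) A"
      using f by (intro extensionalityI[of f A]) (auto simp: monotone_bijections_def PiE_def)
    moreover have "monotone_on A (\<lambda>a b. (a, b) \<in> r) (\<le>) p"
    proof (rule monotone_onI)
      fix a b assume ab: "a \<in> A" "b \<in> A" "(a, b) \<in> r"
      then have "\<xi> (p a) \<le> \<xi> (p b)"
        using f by (simp add: f_eq[symmetric] monotone_bijections_def monotone_on_def)
      then show "p a \<le> p b" using ab bij_betwE[OF p] le_iff by blast
    qed
    ultimately show "\<exists>p. linear_extension A r p \<and> f = restrict (\<xi> \<circ> p) A"
      using p by (auto simp: linear_extension_def)
  }
  assume "\<exists>p. linear_extension A r p \<and> f = restrict (\<xi> \<circ> p) A"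
  then obtain p where p: "linear_extension A r p" and f: "f = restrict (\<xi> \<circ> p) A" by blast
  have "bij_betw (\<xi> \<circ> p) A (\<xi> ` ?I)"
    using p[unfolded linear_extension_def, THEN conjunct1] bij by (rule bij_betw_trans)
  then have "bij_betw f A (\<xi> ` ?I)"
    by (rule bij_betw_cong[THEN iffD1, rotated]) (simp add: f)
  moreover have "f \<in> A \<rightarrow>\<^sub>E \<xi> ` ?I"
    using linear_extension_range[OF p] by (auto simp: f)
  moreover have "monotone_on A (\<lambda>a b. (a, b) \<in> r) (\<le>) f"
  proof (rule monotone_onI)
    fix a b assume ab: "a \<in> A" "b \<in> A" "(a, b) \<in> r"
    then have "p a \<le> p b" using p by (simp add: linear_extension_def monotone_on_def)
    then show "f a \<le> f b"
      using ab linear_extension_range[OF p] le_iff by (simp add: f)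
  qed
  ultimately show "f \<in> monotone_bijections A r (\<xi> ` ?I)"
    by (simp add: monotone_bijections_def)
qed

theorem corollary1:
  fixes A :: "'a set" and r :: "'a rel" and N n :: nat
    and \<xi> :: "nat \<Rightarrow> 'b::strict_linorder_ab_semigroup_add" and \<beta> :: "nat \<Rightarrow> 'a"
  assumes "finite A" and "card A = N"
    and "partial_order_on A r"
    and "strict_mono_on {1..N} \<xi>"
    and "1 \<le> n" and "n \<le> N"
    and "inj_on \<beta> {1..n}" and "\<beta> ` {1..n} \<subseteq> A"
    and "\<And>k. k \<in> {1..<n} \<Longrightarrow> (\<beta> k, \<beta> (k + 1)) \<in> r \<and> \<beta> k \<noteq> \<beta> (k + 1)"
  defines "F \<equiv> monotone_bijections A r (\<xi> ` {1..N})"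
  shows "Min (S \<beta> n ` F) = semigroup_sum (\<lambda>k. \<xi> (card (lower_cone A r (\<beta> k)))) n
    \<and> Max (S \<beta> n ` F) = semigroup_sum (\<lambda>k. \<xi> (N - card (upper_cone A r (\<beta> k)) + 1)) n"
proof -
  have trans: "trans r" and refl: "\<And>a. a \<in> A \<Longrightarrow> (a, a) \<in> r"
    using assms(3) by (auto simp: partial_order_on_def preorder_on_def refl_on_def)
  have in_A: "\<beta> k \<in> A" if "k \<in> {1..n}" for k
    using that assms(8) by blast
  have \<xi>_mono: "\<xi> i \<le> \<xi> j" if "i \<le> j" "i \<in> {1..N}" "j \<in> {1..N}" for i j
    using assms(4) that by (simp add: strict_mono_on_less_eq)
  have F_iff: "f \<in> F \<longleftrightarrow> (\<exists>p. linear_extension A r p \<and> f = restrict (\<xi> \<circ> p) A)" for f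
    using monotone_bijections_iff_linear_extension[of A \<xi> f r] assms(2,4) by (simp add: F_def)
  have S_restrict: "S \<beta> n (restrict (\<xi> \<circ> p) A) = semigroup_sum (\<lambda>k. \<xi> (p (\<beta> k))) n" for p
    unfolding S_def using assms(5) in_A by (intro semigroup_sum_cong) auto
  have \<beta>_mono: "(\<beta> i, \<beta> j) \<in> r" if "i \<le> j" "1 \<le> i" "j \<le> n" for i j
    using that
  proof (induction j rule: dec_induct)
    case base
    then show ?case using refl in_A by simp
  next
    case (step j)
    then show ?case using assms(9)[of j] trans by (auto dest: transD)
  qed
  have chain: "(x, y) \<in> r \<or> (y, x) \<in> r" if xy: "x \<in> \<beta> ` {1..n}" "y \<in> \<beta> ` {1..n}" for x y
  proof -
    obtain i j where "x = \<beta> i" "y = \<beta> j" "i \<in> {1..n}" "j \<in> {1..n}" using xy by blast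
    then show ?thesis using \<beta>_mono[of i j] \<beta>_mono[of j i] by fastforce
  qed
  have finite: "finite (S \<beta> n ` F)"
    using assms(1) by (simp add: F_def finite_monotone_bijections)
  obtain p where p: "linear_extension A r p"
    and p_eq: "\<And>k. k \<in> {1..n} \<Longrightarrow> p (\<beta> k) = card (lower_cone A r (\<beta> k))"
    using linear_extension_minimal_on_chain[OF assms(1,3,8) chain] by blast
  obtain q where q: "linear_extension A r q"
    and q_eq: "\<And>k. k \<in> {1..n} \<Longrightarrow> q (\<beta> k) = N - card (upper_cone A r (\<beta> k)) + 1"
    using linear_extension_maximal_on_chain[OF assms(1,3,8) chain] assms(2) by blast
  \<comment> \<open>The claimed extrema are the sums for the extensions \<open>p\<close> and
    \<open>q\<close>, so it remains to compare these with all others.\<close>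
  have min_eq: "semigroup_sum (\<lambda>k. \<xi> (card (lower_cone A r (\<beta> k)))) n
      = semigroup_sum (\<lambda>k. \<xi> (p (\<beta> k))) n"
    using assms(5) p_eq by (intro semigroup_sum_cong) auto
  have max_eq: "semigroup_sum (\<lambda>k. \<xi> (N - card (upper_cone A r (\<beta> k)) + 1)) n
      = semigroup_sum (\<lambda>k. \<xi> (q (\<beta> k))) n"
    using assms(5) q_eq by (intro semigroup_sum_cong) auto
  \<comment> \<open>At every chain element simultaneously, \<open>p\<close> is a lower and
    \<open>q\<close> an upper bound for all linear extensions, so sums can be compared
    termwise.\<close>
  have between: "p (\<beta> k) \<le> e (\<beta> k) \<and> e (\<beta> k) \<le> q (\<beta> k)"
    if "linear_extension A r e" "k \<in> {1..n}" for e k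
    using card_lower_cone_le[OF that(1) in_A[OF that(2)]]
      le_card_upper_cone[OF that(1) in_A[OF that(2)]] p_eq q_eq that(2) assms(2) by simp
  \<comment> \<open>Monotonicity of \<open>\<xi>\<close> is given only on \<open>{1..N}\<close>, so
    positions must be located there.\<close>
  have range: "e (\<beta> k) \<in> {1..N}" if "linear_extension A r e" "k \<in> {1..n}" for e k
    using linear_extension_range[OF that(1) in_A[OF that(2)]] assms(2) by simp
  have lower: "semigroup_sum (\<lambda>k. \<xi> (p (\<beta> k))) n \<le> S \<beta> n f"
    and upper: "S \<beta> n f \<le> semigroup_sum (\<lambda>k. \<xi> (q (\<beta> k))) n" if f: "f \<in> F" for f
  proof -
    obtain e where e: "linear_extension A r e" "f = restrict (\<xi> \<circ> e) A"
      using f F_iff by blast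
    show "semigroup_sum (\<lambda>k. \<xi> (p (\<beta> k))) n \<le> S \<beta> n f"
      unfolding e(2) S_restrict using assms(5) between[OF e(1)] range[OF e(1)] range[OF p]
      by (intro semigroup_sum_mono \<xi>_mono) simp_all
    show "S \<beta> n f \<le> semigroup_sum (\<lambda>k. \<xi> (q (\<beta> k))) n"
      unfolding e(2) S_restrict using assms(5) between[OF e(1)] range[OF e(1)] range[OF q]
      by (intro semigroup_sum_mono \<xi>_mono) simp_all
  qed
  have attained: "semigroup_sum (\<lambda>k. \<xi> (e (\<beta> k))) n \<in> S \<beta> n ` F"
    if "linear_extension A r e" for e
    unfolding S_restrict[symmetric] by (rule imageI, rule F_iff[THEN iffD2]) (use that in blast)
  show ?thesis
    unfolding min_eq max_eq
    using finite lower upper attained[OF p] attained[OF q]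
    by (intro conjI Min_eqI Max_eqI) auto
qed

end
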